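(* Let $f_1,f_2:\mathbb R^+\to\mathbb R^+$ be continuous and strictly increasing with $f_i(x)>0$ for $x>0$, $i=1,2$. Assume that the equation $f_1^{-1}(x)=f_2(x)$ has exactly one positive solution $K>0$, where $f_2(x)>f_1^{-1}(x)$ for $f_1(0)<x<K$ and $f_2(x)<f_1^{-1}(x)$ for $x>K$. Let $h_i:\mathbb R^+\to\mathbb R$ ($i=1,2$) be Lebesgue measurable with $h_i(t)\le t$ and $\lim_{t\to\infty}h_i(t)=\infty$. For $i=1,2$ let $R_i(t,\cdot)$ be left continuous and non-decreasing for any $t$, let $R_i(\cdot,s)$ be locally integrable for any $s$, let $R_i(t,s)=0$ for $s\le h_i(t)$ and $R_i(t,t^+)=1$, and let $r_i$ be a Lebesgue measurable essentially bounded function on $\mathbb R^+$ with $r_i(t)\ge 0$ and $\int_0^\infty r_i(s)\,ds=\infty$. Let $\varphi,\psi:(-\infty,0]\to\mathbb R$ be continuous bounded functions with $\varphi(t)\ge 0$, $\psi(t)\ge 0$ for $t<0$ and $\varphi(0)>0$, $\psi(0)>0$. Then any solution $(x,y)$ of the initial value problem (P) described in the context converges to the unique positive equilibrium: $(x(t),y(t))\to(K,f_2(K))$ as $t\to\infty$.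
   Context: $\mathbb R^+=[0,\infty)$; $u(t^+)$ is the right-side limit of $u$ at $t$. Problem (P) is the system $$x'(t)=r_1(t)\left[\int_{h_1(t)}^t f_1(y(s))\,d_sR_1(t,s)-x(t)\right],\quad y'(t)=r_2(t)\left[\int_{h_2(t)}^t f_2(x(s))\,d_sR_2(t,s)-y(t)\right]$$ with the initial conditions $x(t)=\varphi(t)$, $y(t)=\psi(t)$ for $t\le 0$. The integrals are Stieltjes integrals in $s$ over $[h_i(t),t]$ including the endpoint atoms, i.e. with respect to the probability measure on $[h_i(t),t]$ with (left continuous) distribution function $R_i(t,\cdot)$. A solution is a pair $(x,y)$, locally absolutely continuous on $[0,\infty)$, which satisfies the system for almost all $t\ge0$ and the initial conditions for $t\le0$. Convention: $f_1^{-1}$ is the inverse of $f_1$ on its range, $f_1^{-1}(x)=0$ for $0\le x<f_1(0)$, and $f_1^{-1}(x)=+\infty$ for $x$ above the range of $f_1$. *)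

theory Defs
  imports "HOL-Analysis.Analysis"
begin

text \<open>
  Functions given on \<open>[0,\<infinity>)\<close> are total functions on the reals that are
  constrained on \<open>[0,\<infinity>)\<close> only. Likewise \<open>R t s\<close> matters only for \<open>t \<ge> 0\<close>.
\<close>

definition increasing_nonlinearity :: "(real \<Rightarrow> real) \<Rightarrow> bool" where
  "increasing_nonlinearity f \<longleftrightarrow>
     f ` {0..} \<subseteq> {0..} \<and> continuous_on {0..} f \<and> strict_mono_on {0..} f \<and> (\<forall>x>0. f x > 0)"

text \<open>The inverse of \<open>f\<close> on its range, extended by \<open>0\<close> below and by \<open>\<infinity>\<close> above the range.\<close>

definition ext_inverse :: "(real \<Rightarrow> real) \<Rightarrow> real \<Rightarrow> ereal" where
  "ext_inverse f x =
     (if x < f 0 then 0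
      else if x \<in> f ` {0..} then ereal (the_inv_into {0..} f x)
      else \<infinity>)"

definition delay_function :: "(real \<Rightarrow> real) \<Rightarrow> bool" where
  "delay_function h \<longleftrightarrow>
     h \<in> borel_measurable (lebesgue_on {0..}) \<and> (\<forall>t\<ge>0. h t \<le> t) \<and> filterlim h at_top at_top"

definition delay_kernel :: "(real \<Rightarrow> real) \<Rightarrow> (real \<Rightarrow> real \<Rightarrow> real) \<Rightarrow> bool" where
  "delay_kernel h R \<longleftrightarrow>
     (\<forall>t\<ge>0. (\<forall>s. continuous (at_left s) (R t)) \<and> mono (R t)) \<and>
     (\<forall>s. \<forall>b\<ge>0. (\<lambda>t. R t s) absolutely_integrable_on {0..b}) \<and>
     (\<forall>t\<ge>0. \<forall>s\<le>h t. R t s = 0) \<and>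
     (\<forall>t\<ge>0. (R t \<longlongrightarrow> 1) (at_right t))"

definition rate_function :: "(real \<Rightarrow> real) \<Rightarrow> bool" where
  "rate_function r \<longleftrightarrow>
     r \<in> borel_measurable (lebesgue_on {0..}) \<and>
     (\<exists>M. AE t in lebesgue_on {0..}. \<bar>r t\<bar> \<le> M) \<and>
     (\<forall>t\<ge>0. r t \<ge> 0) \<and>
     (\<integral>\<^sup>+ t. ennreal (r t) \<partial>lebesgue_on {0..}) = \<infinity>"

definition initial_function :: "(real \<Rightarrow> real) \<Rightarrow> bool" where
  "initial_function \<phi> \<longleftrightarrow>
     continuous_on {..0} \<phi> \<and> bounded (\<phi> ` {..0}) \<and> (\<forall>t<0. \<phi> t \<ge> 0) \<and> \<phi> 0 > 0"

text \<open>
  The Lebesgue-Stieltjes measure that gives \<open>[a,b)\<close> the mass \<open>F b - F a\<close>, for \<open>F\<close>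
  non-decreasing and left continuous. Since \<^const>\<open>interval_measure\<close> expects right continuous
  functions, \<open>F\<close> is replaced by its right limits.
\<close>

definition stieltjes_measure :: "(real \<Rightarrow> real) \<Rightarrow> real measure" where
  "stieltjes_measure F = interval_measure (\<lambda>s. Lim (at_right s) F)"

text \<open>The integral over the closed interval \<open>[a,b]\<close>, atoms at both endpoints included.\<close>

definition stieltjes_integral ::
    "real \<Rightarrow> real \<Rightarrow> (real \<Rightarrow> real) \<Rightarrow> (real \<Rightarrow> real) \<Rightarrow> real" where
  "stieltjes_integral a b g F = (LINT s:{a..b}|stieltjes_measure F. g s)"

definition abs_continuous_on :: "real \<Rightarrow> real \<Rightarrow> (real \<Rightarrow> real) \<Rightarrow> bool" where
  "abs_continuous_on a b f \<longleftrightarrow>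
     (\<forall>\<epsilon>>0. \<exists>\<delta>>0. \<forall>(n::nat) u v.
        (\<forall>i<n. a \<le> u i \<and> u i \<le> v i \<and> v i \<le> b) \<and>
        disjoint_family_on (\<lambda>i. {u i<..<v i}) {..<n} \<and>
        (\<Sum>i<n. v i - u i) < \<delta> \<longrightarrow>
        (\<Sum>i<n. \<bar>f (v i) - f (u i)\<bar>) < \<epsilon>)"

definition locally_abs_continuous :: "(real \<Rightarrow> real) \<Rightarrow> bool" where
  "locally_abs_continuous f \<longleftrightarrow> (\<forall>b\<ge>0. abs_continuous_on 0 b f)"

text \<open>
  \<open>x\<close> and \<open>y\<close> are not required to be nonnegative. The initial data are nonnegative with positive
  values at \<open>0\<close>, and \<open>x' \<ge> - r x\<close> holds as long as the arguments of the nonlinearities are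
  nonnegative, so a solution never leaves the domain \<open>[0,\<infinity>)\<close> of the nonlinearities and their
  values at negative arguments play no role.
\<close>

definition solution_P ::
    "(real \<Rightarrow> real) \<Rightarrow> (real \<Rightarrow> real) \<Rightarrow> (real \<Rightarrow> real) \<Rightarrow> (real \<Rightarrow> real) \<Rightarrow>
     (real \<Rightarrow> real \<Rightarrow> real) \<Rightarrow> (real \<Rightarrow> real \<Rightarrow> real) \<Rightarrow> (real \<Rightarrow> real) \<Rightarrow> (real \<Rightarrow> real) \<Rightarrow>
     (real \<Rightarrow> real) \<Rightarrow> (real \<Rightarrow> real) \<Rightarrow> (real \<Rightarrow> real) \<Rightarrow> (real \<Rightarrow> real) \<Rightarrow> bool" where
  "solution_P f\<^sub>1 f\<^sub>2 h\<^sub>1 h\<^sub>2 R\<^sub>1 R\<^sub>2 r\<^sub>1 r\<^sub>2 \<phi> \<psi> x y \<longleftrightarrow>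
     locally_abs_continuous x \<and> locally_abs_continuous y \<and>
     (AE t in lebesgue_on {0..}.
        (x has_real_derivative
           r\<^sub>1 t * (stieltjes_integral (h\<^sub>1 t) t (\<lambda>s. f\<^sub>1 (y s)) (R\<^sub>1 t) - x t)) (at t) \<and>
        (y has_real_derivative
           r\<^sub>2 t * (stieltjes_integral (h\<^sub>2 t) t (\<lambda>s. f\<^sub>2 (x s)) (R\<^sub>2 t) - y t)) (at t)) \<and>
     (\<forall>t\<le>0. x t = \<phi> t \<and> y t = \<psi> t)"

end

theory Submission
  imports Defs
begin

text \<open>
  Boxes \<open>[p,P] \<times> [q,Q]\<close> with \<open>p \<le> f\<^sub>1 q\<close>, \<open>q \<le> f\<^sub>2 p\<close>, \<open>f\<^sub>1 Q \<le> P\<close> and \<open>f\<^sub>2 P \<le> Q\<close> are invariant, since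
  each component relaxes towards an average of values of the nonlinearity over the box. The
  hypotheses on \<open>K\<close> say that \<open>f\<^sub>1 \<circ> f\<^sub>2\<close> lies above the diagonal on \<open>(0,K)\<close> and below it on
  \<open>(K,\<infinity>)\<close>, so there are arbitrarily large invariant boxes with \<open>p = q = 0\<close>, and, once the delayed
  arguments are nonnegative, invariant boxes with \<open>p > 0\<close>. Hence \<open>x\<close> is bounded and bounded away
  from \<open>0\<close>. Because \<open>\<integral>r\<^sub>i = \<infinity>\<close>, an eventual lower bound \<open>c\<close> of \<open>x\<close> improves to every number below
  \<open>f\<^sub>1 (f\<^sub>2 c)\<close>; so the largest asymptotic lower bound is at least \<open>K\<close>, and dually from above.
\<close>

section \<open>Absolutely continuous functions\<close>

lemma abs_continuous_on_subinterval:
  assumes "abs_continuous_on a b f" "a \<le> a'" "b' \<le> b"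
  shows "abs_continuous_on a' b' f"
  unfolding abs_continuous_on_def
proof (intro allI impI)
  fix \<epsilon> :: real assume "\<epsilon> > 0"
  then obtain \<delta> where \<delta>: "\<delta> > 0" and *: "\<forall>(n::nat) u v.
        (\<forall>i<n. a \<le> u i \<and> u i \<le> v i \<and> v i \<le> b) \<and>
        disjoint_family_on (\<lambda>i. {u i<..<v i}) {..<n} \<and>
        (\<Sum>i<n. v i - u i) < \<delta> \<longrightarrow>
        (\<Sum>i<n. \<bar>f (v i) - f (u i)\<bar>) < \<epsilon>"
    using assms(1) unfolding abs_continuous_on_def by meson
  show "\<exists>\<delta>>0. \<forall>(n::nat) u v.
        (\<forall>i<n. a' \<le> u i \<and> u i \<le> v i \<and> v i \<le> b') \<and>
        disjoint_family_on (\<lambda>i. {u i<..<v i}) {..<n} \<and>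
        (\<Sum>i<n. v i - u i) < \<delta> \<longrightarrow>
        (\<Sum>i<n. \<bar>f (v i) - f (u i)\<bar>) < \<epsilon>"
    using \<delta> assms(2,3) by (intro exI[of _ \<delta>] conjI allI impI *[rule_format]) force+
qed

lemma abs_continuous_on_uminus:
  "abs_continuous_on a b f \<Longrightarrow> abs_continuous_on a b (\<lambda>t. - f t)"
  unfolding abs_continuous_on_def by (simp add: abs_minus_commute)

lemma abs_continuous_on_imp_continuous_on:
  assumes "abs_continuous_on a b f"
  shows "continuous_on {a..b} f"
  unfolding continuous_on_iff
proof (intro ballI allI impI)
  fix t \<epsilon> :: real assume t: "t \<in> {a..b}" and "\<epsilon> > 0"
  then obtain \<delta> where \<delta>: "\<delta> > 0" and *: "\<And>(n::nat) u v.
        (\<forall>i<n. a \<le> u i \<and> u i \<le> v i \<and> v i \<le> b) \<and>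
        disjoint_family_on (\<lambda>i. {u i<..<v i}) {..<n} \<and>
        (\<Sum>i<n. v i - u i) < \<delta> \<Longrightarrow>
        (\<Sum>i<n. \<bar>f (v i) - f (u i)\<bar>) < \<epsilon>"
    using assms unfolding abs_continuous_on_def by meson
  have "\<bar>f s - f t\<bar> < \<epsilon>" if "s \<in> {a..b}" "\<bar>s - t\<bar> < \<delta>" for s
    \<comment> \<open>A family with one interval is enough; the two instances cover both orders of
      \<open>s\<close> and \<open>t\<close>.\<close>
    using *[of 1 "\<lambda>_. s" "\<lambda>_. t"] *[of 1 "\<lambda>_. t" "\<lambda>_. s"] that t
    by (cases "s \<le> t") (auto simp: disjoint_family_on_def)
  then show "\<exists>d>0. \<forall>s\<in>{a..b}. dist s t < d \<longrightarrow> dist (f s) (f t) < \<epsilon>"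
    using \<delta> by (auto simp: dist_real_def)
qed

text \<open>The increment splits at \<open>t\<close>, and the errors \<open>e * (t - u)\<close> and
  \<open>e * (v - t)\<close> add up to \<open>e * (v - u)\<close>. In a tagged division the tag lies
  between the endpoints, so this controls one tagged interval.\<close>

lemma has_real_derivative_imp_straddle:
  fixes f :: "real \<Rightarrow> real"
  assumes "(f has_real_derivative D) (at t)" "e > 0"
  obtains d where "d > 0"
    "\<And>u v. u \<le> t \<Longrightarrow> t \<le> v \<Longrightarrow> t - u < d \<Longrightarrow> v - t < d \<Longrightarrow> (D - e) * (v - u) \<le> f v - f u"
proof -
  obtain d where d: "d > 0"
    and *: "\<And>y. norm (y - t) < d \<Longrightarrow> norm (f y - f t - D * (y - t)) \<le> e * norm (y - t)"
    using assms unfolding has_field_derivative_def has_derivative_at_alt by blast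
  show thesis
  proof
    fix u v assume "u \<le> t" "t \<le> v" "t - u < d" "v - t < d"
    then show "(D - e) * (v - u) \<le> f v - f u"
      using *[of u] *[of v] by (simp add: abs_le_iff algebra_simps)
  qed (fact d)
qed

text \<open>The gauge forces every interval tagged in \<open>N\<close> into an open set
  \<open>U\<close> of measure less than \<open>\<delta>\<close>. These intervals do not overlap, so
  their total length is less than \<open>\<delta>\<close> and absolute continuity applies to
  them.\<close>

lemma abs_continuous_on_tagged_sum:
  assumes f: "abs_continuous_on a b f" and N: "negligible N" and e: "e > 0"
  obtains \<gamma> where "gauge \<gamma>"
    "\<And>p. p tagged_division_of {a..b} \<Longrightarrow> \<gamma> fine p \<Longrightarrow>
       (\<Sum>(x,J)\<in>{q \<in> p. fst q \<in> N}. \<bar>f (Sup J) - f (Inf J)\<bar>) < e"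
proof -
  obtain \<delta> where \<delta>: "\<delta> > 0" and *: "\<And>(n::nat) u v.
        (\<forall>i<n. a \<le> u i \<and> u i \<le> v i \<and> v i \<le> b) \<and>
        disjoint_family_on (\<lambda>i. {u i<..<v i}) {..<n} \<and>
        (\<Sum>i<n. v i - u i) < \<delta> \<Longrightarrow>
        (\<Sum>i<n. \<bar>f (v i) - f (u i)\<bar>) < e"
    using f e unfolding abs_continuous_on_def by meson
  obtain U where U: "open U" "N \<subseteq> U" "U \<in> lmeasurable" "measure lebesgue U < \<delta>"
  proof -
    have N': "N \<in> null_sets lebesgue" using N by (simp add: negligible_iff_null_sets)
    then obtain U where U: "open U" "N \<subseteq> U" "U - N \<in> lmeasurable"
        "emeasure lebesgue (U - N) < ennreal \<delta>"
      using sets_lebesgue_outer_open[of N \<delta>] \<delta> by auto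
    have "emeasure lebesgue U = emeasure lebesgue (U - N)"
      using N' U(1) by (simp add: emeasure_Diff_null_set)
    then have "emeasure lebesgue U < ennreal \<delta>" using U by simp
    moreover from this have "U \<in> lmeasurable"
      using U(1) by (auto simp: fmeasurable_def intro: less_trans)
    ultimately show thesis
      using that U(1,2) \<delta> by (simp add: emeasure_eq_measure2 ennreal_less_iff)
  qed
  define \<gamma> where "\<gamma> x = (if x \<in> N then U else UNIV)" for x :: real
  have "gauge \<gamma>"
    unfolding gauge_def \<gamma>_def using U by auto
  moreover have "(\<Sum>(x,J)\<in>{q \<in> p. fst q \<in> N}. \<bar>f (Sup J) - f (Inf J)\<bar>) < e"
    if p: "p tagged_division_of {a..b}" and fine: "\<gamma> fine p" for p
  proof -
    define P where "P = {q \<in> p. fst q \<in> N}"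
    have "finite P" using p unfolding P_def by auto
    then obtain \<beta> where \<beta>: "bij_betw \<beta> {..<card P} P"
      using ex_bij_betw_nat_finite[of P] by (auto simp: atLeast0LessThan)
    define u where "u i = Inf (snd (\<beta> i))" for i
    define v where "v i = Sup (snd (\<beta> i))" for i
    have mem: "\<beta> i \<in> P" if "i < card P" for i
      using \<beta> that by (auto simp: bij_betw_def)
    have K: "snd (\<beta> i) = {u i..v i} \<and> a \<le> u i \<and> u i \<le> v i \<and> v i \<le> b \<and> {u i..v i} \<subseteq> U"
      if i: "i < card P" for i
    proof -
      obtain x J where xJ: "\<beta> i = (x, J)" by force
      then have xp: "(x, J) \<in> p" "x \<in> N" using mem[OF i] by (auto simp: P_def)
      have "x \<in> J" "J \<subseteq> {a..b}" using p xp by auto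
      moreover obtain c d where J: "J = {c..d}" using tagged_division_ofD(4)[OF p xp(1)] by auto
      moreover have "J \<subseteq> U" using fine xp by (fastforce simp: fine_def \<gamma>_def)
      ultimately show ?thesis by (auto simp: u_def v_def xJ)
    qed
    have disj: "disjoint_family_on (\<lambda>i. {u i<..<v i}) {..<card P}"
      unfolding disjoint_family_on_def
    proof (intro ballI impI)
      fix i j assume ij: "i \<in> {..<card P}" "j \<in> {..<card P}" "i \<noteq> j"
      then have "\<beta> i \<noteq> \<beta> j" using \<beta> by (auto simp: bij_betw_def inj_on_def)
      moreover have "\<beta> i \<in> p" "\<beta> j \<in> p" using mem ij by (auto simp: P_def)
      ultimately have "interior (snd (\<beta> i)) \<inter> interior (snd (\<beta> j)) = {}"
        using tagged_division_ofD(5)[OF p] by (metis surjective_pairing)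
      then show "{u i<..<v i} \<inter> {u j<..<v j} = {}" using K ij by simp
    qed
    have "(\<Sum>i<card P. v i - u i) = (\<Sum>i<card P. measure lebesgue {u i<..<v i})"
      using K by (intro sum.cong) auto
    also have "\<dots> = measure lebesgue (\<Union>i<card P. {u i<..<v i})"
      using disj K by (intro measure_finite_Union[symmetric]) auto
    also have "\<dots> \<le> measure lebesgue U"
      using U(3) K by (intro measure_mono_fmeasurable) force+
    finally have "(\<Sum>i<card P. v i - u i) < \<delta>" using U by simp
    then have "(\<Sum>i<card P. \<bar>f (v i) - f (u i)\<bar>) < e"
      using disj K by (intro *) auto
    also have "(\<Sum>i<card P. \<bar>f (v i) - f (u i)\<bar>) = (\<Sum>(x,J)\<in>P. \<bar>f (Sup J) - f (Inf J)\<bar>)"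
      using sum.reindex_bij_betw[OF \<beta>, of "\<lambda>(x,J). \<bar>f (Sup J) - f (Inf J)\<bar>"]
      by (simp add: u_def v_def case_prod_unfold)
    finally show ?thesis unfolding P_def .
  qed
  ultimately show thesis using that by blast
qed

text \<open>
  Over a fine tagged division the derivative controls the increments at tags outside \<open>N\<close>, and
  absolute continuity makes the remaining increments small; no differentiability of indefinite
  integrals is needed.
\<close>

lemma abs_continuous_on_integral_le:
  assumes ab: "a \<le> b" and f: "abs_continuous_on a b f" and N: "negligible N"
    and g: "g integrable_on {a..b}"
    and der: "\<And>t. t \<in> {a..b} - N \<Longrightarrow> \<exists>D\<ge>g t. (f has_real_derivative D) (at t)"
  shows "integral {a..b} g \<le> f b - f a"
proof -
  \<comment> \<open>Setting \<open>g\<close> to \<open>0\<close> on the negligible set keeps the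
    integral and removes the tags in \<open>N\<close> from the Riemann sums.\<close>
  define k where "k t = (if t \<in> N then 0 else g t)" for t
  have k: "(k has_integral integral {a..b} g) {a..b}"
    by (rule has_integral_spike[OF N _ integrable_integral[OF g]]) (auto simp: k_def)
  \<comment> \<open>In \<open>e * (b - a + 2)\<close> the straddle estimate costs
    \<open>e * (b - a)\<close>; the error of the Riemann sum and the increments at tags in
    \<open>N\<close> cost \<open>e\<close> each.\<close>
  have "integral {a..b} g \<le> f b - f a + e * (b - a + 2)" if e: "e > 0" for e
  proof -
    obtain \<gamma>1 where \<gamma>1: "gauge \<gamma>1" "\<And>p. p tagged_division_of {a..b} \<Longrightarrow> \<gamma>1 fine p \<Longrightarrow>
        norm ((\<Sum>(x,J)\<in>p. measure lborel J *\<^sub>R k x) - integral {a..b} g) < e"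
      using k e unfolding has_integral_real by meson
    obtain \<gamma>2 where \<gamma>2: "gauge \<gamma>2" "\<And>p. p tagged_division_of {a..b} \<Longrightarrow> \<gamma>2 fine p \<Longrightarrow>
        (\<Sum>(x,J)\<in>{q \<in> p. fst q \<in> N}. \<bar>f (Sup J) - f (Inf J)\<bar>) < e"
      by (rule abs_continuous_on_tagged_sum[OF f N e]) blast
    have "\<exists>d>0. t \<in> {a..b} - N \<longrightarrow> (\<forall>u v. u \<le> t \<longrightarrow> t \<le> v \<longrightarrow> t - u < d \<longrightarrow> v - t < d \<longrightarrow>
        (g t - e) * (v - u) \<le> f v - f u)" for t
    proof (cases "t \<in> {a..b} - N")
      case True
      then obtain D where D: "D \<ge> g t" "(f has_real_derivative D) (at t)" using der by blast
      obtain d where d: "d > 0"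
        "\<And>u v. u \<le> t \<Longrightarrow> t \<le> v \<Longrightarrow> t - u < d \<Longrightarrow> v - t < d \<Longrightarrow> (D - e) * (v - u) \<le> f v - f u"
        by (rule has_real_derivative_imp_straddle[OF D(2) e]) blast
      have "(g t - e) * (v - u) \<le> f v - f u"
        if "u \<le> t" "t \<le> v" "t - u < d" "v - t < d" for u v
        using d(2)[OF that] D(1) mult_right_mono[of "g t - e" "D - e" "v - u"] that by linarith
      then show ?thesis using d(1) by blast
    qed (auto intro: exI[of _ 1])
    then obtain d where d: "\<And>t. d t > 0" "\<And>t u v. t \<in> {a..b} - N \<Longrightarrow> u \<le> t \<Longrightarrow> t \<le> v \<Longrightarrow>
        t - u < d t \<Longrightarrow> v - t < d t \<Longrightarrow> (g t - e) * (v - u) \<le> f v - f u"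
      by metis
    define \<gamma> where "\<gamma> t = \<gamma>1 t \<inter> \<gamma>2 t \<inter> ball t (d t)" for t
    have "gauge \<gamma>" using \<gamma>1(1) \<gamma>2(1) d(1) by (auto simp: \<gamma>_def gauge_def)
    then obtain p where p: "p tagged_division_of {a..b}" and "\<gamma> fine p"
      using fine_division_exists_real by blast
    then have fine: "\<gamma>1 fine p" "\<gamma>2 fine p" "(\<lambda>t. ball t (d t)) fine p"
      by (auto simp: \<gamma>_def fine_def)
    have fin: "finite p" using p by auto
    \<comment> \<open>\<open>w\<close> pays for a possible decrease of \<open>f\<close> over an
      interval tagged in \<open>N\<close>, so that \<open>step\<close> holds for every tag.\<close>
    define w where "w q = (if fst q \<in> N then \<bar>f (Sup (snd q)) - f (Inf (snd q))\<bar> else 0)" for q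
    have step: "measure lborel J * k x - e * measure lborel J \<le> (f (Sup J) - f (Inf J)) + w (x, J)"
      if xJ: "(x, J) \<in> p" for x J
    proof -
      obtain u v where J: "J = {u..v}" using tagged_division_ofD(4)[OF p xJ] by auto
      have x: "x \<in> J" "J \<subseteq> {a..b}" using p xJ by auto
      then have uv: "u \<le> x" "x \<le> v" by (auto simp: J)
      have c: "measure lborel J = v - u" "Sup J = v" "Inf J = u" using uv by (auto simp: J)
      have "J \<subseteq> ball x (d x)" using fine(3) xJ by (auto simp: fine_def)
      moreover have "u \<in> J" "v \<in> J" using uv by (auto simp: J)
      ultimately have "u \<in> ball x (d x)" "v \<in> ball x (d x)" by blast+
      then have near: "x - u < d x" "v - x < d x"
        using uv by (auto simp: dist_real_def)
      show ?thesis
      proof (cases "x \<in> N")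
        case True
        moreover have "0 \<le> e * (v - u)" using e uv by simp
        ultimately show ?thesis by (simp add: k_def w_def c)
      next
        case False
        then have "(g x - e) * (v - u) \<le> f v - f u" using d(2) x uv near by blast
        then show ?thesis using False by (simp add: k_def w_def c algebra_simps)
      qed
    qed
    have "(\<Sum>q\<in>p. w q) = (\<Sum>(x,J)\<in>{q \<in> p. fst q \<in> N}. \<bar>f (Sup J) - f (Inf J)\<bar>)"
      using fin by (simp add: w_def sum.inter_filter case_prod_unfold)
    then have w: "(\<Sum>q\<in>p. w q) < e" using \<gamma>2(2)[OF p fine(2)] by simp
    have "(\<Sum>(x,J)\<in>p. measure lborel J * k x) - e * (b - a)
        = (\<Sum>(x,J)\<in>p. measure lborel J * k x - e * measure lborel J)"
      using additive_content_tagged_division[of p a b] p ab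
      by (simp add: case_prod_unfold sum_subtractf sum_distrib_left[symmetric])
    also have "\<dots> \<le> (\<Sum>(x,J)\<in>p. (f (Sup J) - f (Inf J)) + w (x, J))"
      using step by (intro sum_mono) auto
    also have "\<dots> = (f b - f a) + (\<Sum>q\<in>p. w q)"
      using additive_tagged_division_1[OF ab p, of f] by (simp add: case_prod_unfold sum.distrib)
    finally show ?thesis
      using w \<gamma>1(2)[OF p fine(1)] by (simp add: algebra_simps abs_less_iff)
  qed
  then have "integral {a..b} g \<le> f b - f a + \<eta>" if "\<eta> > 0" for \<eta>
    using that ab by (auto dest!: meta_spec[of _ "\<eta> / (b - a + 2)"])
  then show ?thesis by (rule field_le_epsilon)
qed

section \<open>Stieltjes averages\<close>

lemma mono_right_limit:
  fixes F :: "real \<Rightarrow> real"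
  assumes F: "mono F"
  shows "(F \<longlongrightarrow> Inf (F ` {s<..})) (at_right s)"
  using Lim_right_bound[of UNIV s F "F s"] F by (auto simp: mono_def)

lemma Lim_at_right_mono:
  fixes F :: "real \<Rightarrow> real"
  assumes F: "mono F"
  shows "(F \<longlongrightarrow> Lim (at_right s) F) (at_right s)"
  using mono_right_limit[OF F, of s] by (simp add: tendsto_Lim)

lemma Lim_at_right_le:
  fixes F :: "real \<Rightarrow> real"
  assumes F: "mono F" and st: "s < t"
  shows "Lim (at_right s) F \<le> F t"
proof (rule tendsto_upperbound[OF Lim_at_right_mono[OF F]])
  show "\<forall>\<^sub>F u in at_right s. F u \<le> F t"
    using st F unfolding eventually_at_right_field by (intro exI[of _ t]) (auto simp: mono_def)
qed simp

lemma le_Lim_at_right: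
  fixes F :: "real \<Rightarrow> real"
  assumes F: "mono F" and st: "s \<le> t"
  shows "F s \<le> Lim (at_right t) F"
proof (rule tendsto_lowerbound[OF Lim_at_right_mono[OF F]])
  show "\<forall>\<^sub>F u in at_right t. F s \<le> F u"
    using st F unfolding eventually_at_right_field by (intro exI[of _ "t + 1"]) (auto simp: mono_def)
qed simp

lemma mono_Lim_at_right:
  fixes F :: "real \<Rightarrow> real"
  assumes F: "mono F" and st: "s \<le> t"
  shows "Lim (at_right s) F \<le> Lim (at_right t) F"
  using st Lim_at_right_le[OF F, of s t] le_Lim_at_right[OF F, of t t] by (cases "s = t") auto

text \<open>\<open>interval_measure\<close> expects right continuity. If \<open>F\<close> stays
  below \<open>c\<close> on an interval to the right of \<open>s\<close>, each right limit inside it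
  is bounded by a later value of \<open>F\<close> in the same interval; the lower estimate is
  monotonicity.\<close>

lemma continuous_Lim_at_right:
  fixes F :: "real \<Rightarrow> real"
  assumes F: "mono F"
  shows "continuous (at_right s) (\<lambda>s. Lim (at_right s) F)"
  unfolding continuous_within
proof (rule order_tendstoI)
  fix c assume c: "c < Lim (at_right s) F"
  then show "\<forall>\<^sub>F u in at_right s. c < Lim (at_right u) F"
    unfolding eventually_at_right_field
    by (intro exI[of _ "s + 1"]) (use mono_Lim_at_right[OF F] in \<open>force intro: less_le_trans\<close>)
next
  fix c assume c: "Lim (at_right s) F < c"
  have "\<forall>\<^sub>F t in at_right s. F t < c"
    using order_tendstoD(2)[OF Lim_at_right_mono[OF F] c] .
  then obtain t where t: "s < t" "\<And>u. s < u \<Longrightarrow> u < t \<Longrightarrow> F u < c"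
    unfolding eventually_at_right_field by blast
  show "\<forall>\<^sub>F u in at_right s. Lim (at_right u) F < c"
    unfolding eventually_at_right_field
  proof (intro exI[of _ t] conjI allI impI)
    fix u assume u: "s < u" "u < t"
    have "Lim (at_right u) F \<le> F ((u + t) / 2)" using u by (intro Lim_at_right_le[OF F]) simp
    also have "\<dots> < c" using u by (intro t) auto
    finally show "Lim (at_right u) F < c" .
  qed (fact t)
qed

text \<open>The right limits vanish to the left of \<open>a\<close> and equal \<open>1\<close> at
  \<open>b\<close>, so every half-open interval that starts left of \<open>a\<close> and ends at
  \<open>b\<close> has mass \<open>1\<close>. Shrinking these intervals to \<open>{a..b}\<close>
  keeps the atom at \<open>a\<close>.\<close>

lemma emeasure_stieltjes_measure_Icc_eq_1:
  assumes F: "mono F" and zero: "\<And>s. s \<le> a \<Longrightarrow> F s = 0" and one: "(F \<longlongrightarrow> 1) (at_right b)"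
    and ab: "a \<le> b"
  shows "emeasure (stieltjes_measure F) {a..b} = 1"
proof -
  let ?M = "stieltjes_measure F" and ?G = "\<lambda>s. Lim (at_right s) F"
  have Gb: "?G b = 1" using one by (simp add: tendsto_Lim)
  \<comment> \<open>Strictness matters: an atom at \<open>a\<close> makes the right limit at
    \<open>a\<close> itself positive.\<close>
  have Gs: "?G s = 0" if "s < a" for s
    using le_Lim_at_right[OF F, of s s] Lim_at_right_le[OF F that] zero that by simp
  have E: "emeasure ?M {a - 1 / real (Suc n) <.. b} = 1" for n
  proof -
    have "emeasure ?M {a - 1 / real (Suc n) <.. b} = ennreal (?G b - ?G (a - 1 / real (Suc n)))"
      unfolding stieltjes_measure_def using ab
      by (intro emeasure_interval_measure_Ioc mono_Lim_at_right continuous_Lim_at_right F)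
        (auto intro: order_trans[of _ a])
    then show ?thesis using Gb Gs[of "a - 1 / real (Suc n)"] by simp
  qed
  have "(\<Inter>n. {a - 1 / real (Suc n) <.. b}) = {a..b}"
  proof safe
    fix s assume s: "s \<in> (\<Inter>n. {a - 1 / real (Suc n) <.. b})"
    have "a - s \<le> 0 + e" if "e > 0" for e
    proof -
      obtain n where n: "1 / real (Suc n) < e" using nat_approx_posE \<open>e > 0\<close> by blast
      then show ?thesis using s by (auto dest!: spec[of _ n])
    qed
    then have "a \<le> s" using field_le_epsilon[of "a - s" 0] by simp
    then show "s \<in> {a..b}" using s by auto
  next
    fix s n assume "s \<in> {a..b}"
    moreover have "a - 1 / real (Suc n) < a" by simp
    ultimately show "s \<in> {a - 1 / real (Suc n) <.. b}"
      unfolding atLeastAtMost_iff greaterThanAtMost_iff by (metis less_le_trans)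
  qed
  moreover have "(\<lambda>n. emeasure ?M {a - 1 / real (Suc n) <.. b})
      \<longlonglongrightarrow> emeasure ?M (\<Inter>n. {a - 1 / real (Suc n) <.. b})"
  proof (rule Lim_emeasure_decseq)
    show "range (\<lambda>n. {a - 1 / real (Suc n) <.. b}) \<subseteq> sets ?M"
      by (auto simp: stieltjes_measure_def)
    show "decseq (\<lambda>n. {a - 1 / real (Suc n) <.. b})"
    proof (rule decseq_SucI)
      fix n
      have "1 / real (Suc (Suc n)) \<le> 1 / real (Suc n)" by (simp add: frac_le)
      then show "{a - 1 / real (Suc (Suc n)) <.. b} \<subseteq> {a - 1 / real (Suc n) <.. b}" by auto
    qed
  qed (simp only: E, simp)
  ultimately show ?thesis using E by (simp add: LIMSEQ_const_iff)
qed

text \<open>The measure has mass \<open>1\<close> on \<open>{a..b}\<close>, so constants integrate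
  to themselves, and the integral is monotone. Integrability of \<open>g\<close> comes from its
  bounds.\<close>

lemma stieltjes_integral_bounds:
  assumes F: "mono F" "\<And>s. s \<le> a \<Longrightarrow> F s = 0" "(F \<longlongrightarrow> 1) (at_right b)"
    and ab: "a \<le> b" and g: "continuous_on {a..b} g"
    and bd: "\<And>s. s \<in> {a..b} \<Longrightarrow> l \<le> g s \<and> g s \<le> u"
  shows "l \<le> stieltjes_integral a b g F \<and> stieltjes_integral a b g F \<le> u"
proof -
  let ?M = "stieltjes_measure F"
  have sets: "sets ?M = sets borel" by (simp add: stieltjes_measure_def)
  have M1: "emeasure ?M {a..b} = 1" using emeasure_stieltjes_measure_Icc_eq_1[OF F ab] .
  then have m1: "measure ?M {a..b} = 1" by (simp add: measure_def)
  have const: "integrable ?M (\<lambda>s. indicator {a..b} s *\<^sub>R c)" for c :: real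
    using M1 by (intro integrable_scaleR_left integrable_real_indicator) (auto simp: sets)
  have Ic: "(\<integral>s. indicator {a..b} s *\<^sub>R c \<partial>?M) = c" for c :: real
    using m1 const by (subst integral_scaleR_left) (auto simp: sets stieltjes_measure_def)
  have meas: "(\<lambda>s. indicator {a..b} s *\<^sub>R g s) \<in> borel_measurable ?M"
    using borel_measurable_continuous_on_indicator[OF _ g] measurable_cong_sets[OF sets refl] by auto
  have gi: "integrable ?M (\<lambda>s. indicator {a..b} s *\<^sub>R g s)"
    by (rule Bochner_Integration.integrable_bound[OF const[of "max \<bar>l\<bar> \<bar>u\<bar>"] meas])
      (use bd in \<open>force simp: indicator_def\<close>)
  have "(\<integral>s. indicator {a..b} s *\<^sub>R l \<partial>?M) \<le> (\<integral>s. indicator {a..b} s *\<^sub>R g s \<partial>?M)"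
    by (rule integral_mono[OF const gi]) (use bd in \<open>auto simp: indicator_def\<close>)
  moreover have "(\<integral>s. indicator {a..b} s *\<^sub>R g s \<partial>?M) \<le> (\<integral>s. indicator {a..b} s *\<^sub>R u \<partial>?M)"
    by (rule integral_mono[OF gi const]) (use bd in \<open>auto simp: indicator_def\<close>)
  ultimately show ?thesis
    unfolding stieltjes_integral_def set_lebesgue_integral_def by (simp only: Ic)
qed

section \<open>Rates and relaxation equations\<close>

text \<open>The estimate for absolutely continuous functions is stated with a negligible exceptional
  set; this translates the almost everywhere conditions into that form.\<close>

lemma AE_lebesgue_on_atLeastE:
  assumes "AE t in lebesgue_on {0::real..}. P t"
  obtains N where "negligible N" "\<And>t. t \<ge> 0 \<Longrightarrow> t \<notin> N \<Longrightarrow> P t"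
proof -
  have "AE t in lebesgue. t \<in> {0..} \<longrightarrow> P t" using assms by (subst (asm) AE_restrict_space_iff) auto
  then have "negligible {t. \<not> (t \<in> {0..} \<longrightarrow> P t)}"
    by (simp add: completion.AE_iff_null_sets negligible_iff_null_sets)
  then show thesis by (rule that) auto
qed

lemma rate_function_boundE:
  assumes "rate_function r"
  obtains M N where "M > 0" "negligible N" "\<And>t. t \<ge> 0 \<Longrightarrow> t \<notin> N \<Longrightarrow> r t \<le> M"
proof -
  obtain M where "AE t in lebesgue_on {0..}. \<bar>r t\<bar> \<le> M" using assms unfolding rate_function_def by blast
  then obtain N where "negligible N" "\<And>t. t \<ge> 0 \<Longrightarrow> t \<notin> N \<Longrightarrow> \<bar>r t\<bar> \<le> M"
    by (rule AE_lebesgue_on_atLeastE) blast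
  then show thesis by (intro that[of "max M 1" N]) (auto simp: abs_le_iff le_max_iff_disj)
qed

lemma rate_function_integrable_on:
  assumes r: "rate_function r" and a: "0 \<le> a"
  shows "r integrable_on {a..b}"
proof -
  obtain M N where M: "negligible N" "\<And>t. t \<ge> 0 \<Longrightarrow> t \<notin> N \<Longrightarrow> r t \<le> M"
    by (rule rate_function_boundE[OF r]) blast
  have "AE t in lebesgue. t \<notin> N"
    using M(1) by (simp add: AE_not_in negligible_iff_null_sets)
  then have "AE t in lebesgue. t \<in> {a..b} \<longrightarrow> norm (r t) \<le> M"
  proof (rule eventually_mono)
    fix t assume "t \<notin> N"
    moreover have "r t \<ge> 0" if "t \<ge> 0" using r that by (simp add: rate_function_def)
    ultimately show "t \<in> {a..b} \<longrightarrow> norm (r t) \<le> M" using M(2)[of t] a by simp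
  qed
  then have "AE t in lebesgue_on {a..b}. norm (r t) \<le> M"
    by (subst AE_restrict_space_iff) simp_all
  moreover have "r \<in> borel_measurable (lebesgue_on {a..b})"
    by (rule measurable_restrict_mono[of r lebesgue "{0..}"]) (use r a in \<open>auto simp: rate_function_def\<close>)
  moreover have "finite_measure (lebesgue_on {a..b})"
    by (rule finite_measure_lebesgue_on) auto
  ultimately have "integrable (lebesgue_on {a..b}) r"
    by (intro finite_measure.integrable_const_bound)
  then show ?thesis by (rule integrable_on_lebesgue_on) auto
qed

text \<open>If all integrals from \<open>a\<close> stayed below \<open>C\<close>, those over
  \<open>{0..real n}\<close> would be bounded by \<open>?I\<close>, and monotone convergence would
  make the extended integral of \<open>r\<close> over the half-line finite.\<close>

lemma rate_function_integral_unbounded: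
  assumes r: "rate_function r" and a: "0 \<le> a"
  obtains b where "b \<ge> a" "integral {a..b} r \<ge> C"
proof (rule ccontr)
  assume "\<not> thesis"
  then have less: "integral {a..b} r < C" if "b \<ge> a" for b
    using that \<open>\<And>b. a \<le> b \<Longrightarrow> C \<le> integral {a..b} r \<Longrightarrow> thesis\<close> by force
  have nonneg: "r t \<ge> 0" if "t \<ge> 0" for t using r that by (simp add: rate_function_def)
  let ?I = "integral {0..a} r + C"
  have le: "integral {0..real n} r \<le> ?I" for n
  proof -
    have "integral {0..real n} r \<le> integral {0..max a (real n)} r"
      using nonneg by (intro integral_subset_le rate_function_integrable_on[OF r]) auto
    also have "\<dots> = integral {0..a} r + integral {a..max a (real n)} r"
      using a by (intro Henstock_Kurzweil_Integration.integral_combine[symmetric]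
          rate_function_integrable_on[OF r]) auto
    finally show ?thesis using less[of "max a (real n)"] by simp
  qed
  have meas: "(\<lambda>t. ennreal (r t)) \<in> borel_measurable (lebesgue_on {0..})"
    using r unfolding rate_function_def by (intro measurable_compose[OF _ measurable_ennreal]) blast
  have sup: "(SUP n. ennreal (r t) * indicator {0..real n} t) = ennreal (r t)" if "t \<in> {0..}" for t
  proof (rule antisym)
    obtain n where "t \<le> real n" using real_arch_simple by blast
    then show "ennreal (r t) \<le> (SUP n. ennreal (r t) * indicator {0..real n} t)"
      using that by (intro SUP_upper2[of n]) auto
  qed (auto intro!: SUP_least simp: indicator_def)
  have "(\<integral>\<^sup>+ t. ennreal (r t) \<partial>lebesgue_on {0..})
      = (\<integral>\<^sup>+ t. (SUP n. ennreal (r t) * indicator {0..real n} t) \<partial>lebesgue_on {0..})"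
    using sup by (intro nn_integral_cong) auto
  also have "\<dots> = (SUP n. \<integral>\<^sup>+ t. ennreal (r t) * indicator {0..real n} t \<partial>lebesgue_on {0..})"
  proof (rule nn_integral_monotone_convergence_SUP)
    show "incseq (\<lambda>n t. ennreal (r t) * indicator {0..real n} t)"
      by (auto simp: incseq_def le_fun_def indicator_def)
    have "(\<lambda>t. indicator {0..real n} t :: ennreal) \<in> borel_measurable (lebesgue_on {0..})" for n
      by (intro borel_measurable_indicator) (auto simp: sets_restrict_space_iff)
    then show "(\<lambda>t. ennreal (r t) * indicator {0..real n} t) \<in> borel_measurable (lebesgue_on {0..})" for n
      using meas by auto
  qed
  also have "\<dots> \<le> ennreal ?I"
  proof (rule SUP_least)
    fix n
    have "(r has_integral integral {0..real n} r) {0..real n}"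
      using rate_function_integrable_on[OF r] by blast
    then have *: "((\<lambda>t. if t \<in> {0..real n} then r t else 0) has_integral integral {0..real n} r) UNIV"
      by (simp only: has_integral_restrict_UNIV)
    have "(\<integral>\<^sup>+ t. ennreal (r t) * indicator {0..real n} t \<partial>lebesgue_on {0..})
        = (\<integral>\<^sup>+ t. ennreal (if t \<in> {0..real n} then r t else 0) \<partial>lebesgue)"
      by (subst nn_integral_restrict_space) (auto intro!: nn_integral_cong simp: indicator_def)
    also have "\<dots> = ennreal (integral {0..real n} r)"
      using * nonneg by (subst (asm) has_integral_iff_nn_integral_lebesgue) auto
    also have "\<dots> \<le> ennreal ?I" using le by (rule ennreal_leI)
    finally show "(\<integral>\<^sup>+ t. ennreal (r t) * indicator {0..real n} t \<partial>lebesgue_on {0..}) \<le> ennreal ?I" .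
  qed
  finally show False using r by (simp add: rate_function_def top_unique)
qed

text \<open>The equation \<open>z' = r * (F - z)\<close> almost everywhere, with the delayed average
  abstracted to a forcing \<open>F\<close>. Only bounds on \<open>F\<close> enter the estimates
  below.\<close>

definition relaxation :: "(real \<Rightarrow> real) \<Rightarrow> (real \<Rightarrow> real) \<Rightarrow> (real \<Rightarrow> real) \<Rightarrow> bool" where
  "relaxation r F z \<longleftrightarrow> locally_abs_continuous z \<and>
     (AE t in lebesgue_on {0..}. (z has_real_derivative r t * (F t - z t)) (at t))"

text \<open>The equation is odd in the pair of \<open>F\<close> and \<open>z\<close>, so every upper
  estimate follows from the lower one.\<close>

lemma relaxation_uminus:
  assumes "relaxation r F z"
  shows "relaxation r (\<lambda>t. - F t) (\<lambda>t. - z t)"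
proof -
  have "((\<lambda>t. - z t) has_real_derivative r t * (- F t - - z t)) (at t)"
    if "(z has_real_derivative r t * (F t - z t)) (at t)" for t
    using DERIV_minus[OF that] by (simp add: algebra_simps)
  moreover have "AE t in lebesgue_on {0..}. (z has_real_derivative r t * (F t - z t)) (at t)"
    using assms by (simp add: relaxation_def)
  ultimately have "AE t in lebesgue_on {0..}. ((\<lambda>t. - z t) has_real_derivative r t * (- F t - - z t)) (at t)"
    by (rule eventually_mono[rotated])
  moreover have "locally_abs_continuous (\<lambda>t. - z t)"
    using assms unfolding relaxation_def locally_abs_continuous_def
    by (simp add: abs_continuous_on_uminus)
  ultimately show ?thesis unfolding relaxation_def by (intro conjI)
qed

lemma relaxation_continuous_on:
  assumes "relaxation r F z" "0 \<le> a"
  shows "continuous_on {a..b} z"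
proof (cases "a \<le> b")
  case True
  then have "abs_continuous_on 0 b z"
    using assms by (auto simp: relaxation_def locally_abs_continuous_def)
  then have "abs_continuous_on a b z"
    using assms(2) by (rule abs_continuous_on_subinterval) simp
  then show ?thesis
    by (rule abs_continuous_on_imp_continuous_on)
qed auto

text \<open>Almost everywhere \<open>z' \<ge> e * r\<close>, because \<open>r\<close> is
  nonnegative. The sign of \<open>e\<close> is free: barriers use a negative \<open>e\<close>,
  attraction a positive one.\<close>

lemma relaxation_increment_ge:
  assumes rel: "relaxation r F z" and r: "rate_function r" and ab: "0 \<le> a" "a \<le> b"
    and e: "\<And>t. a < t \<Longrightarrow> t < b \<Longrightarrow> e \<le> F t - z t"
  shows "e * integral {a..b} r \<le> z b - z a"
proof -
  obtain N where N: "negligible N"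
    "\<And>t. t \<ge> 0 \<Longrightarrow> t \<notin> N \<Longrightarrow> (z has_real_derivative r t * (F t - z t)) (at t)"
    using rel unfolding relaxation_def by (auto elim: AE_lebesgue_on_atLeastE)
  have "integral {a..b} (\<lambda>t. e * r t) \<le> z b - z a"
  proof (rule abs_continuous_on_integral_le)
    show "abs_continuous_on a b z"
      using rel ab abs_continuous_on_subinterval[of 0 b z a b]
      by (simp add: relaxation_def locally_abs_continuous_def)
    \<comment> \<open>The endpoints join the exceptional set because \<open>e\<close> bounds
      \<open>F t - z t\<close> only strictly between them.\<close>
    show "negligible (N \<union> {a, b})" using N(1) by (auto intro: negligible_Un)
    show "(\<lambda>t. e * r t) integrable_on {a..b}"
      using rate_function_integrable_on[OF r ab(1)] by (rule integrable_on_mult_right)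
    fix t assume t: "t \<in> {a..b} - (N \<union> {a, b})"
    then have "e * r t \<le> r t * (F t - z t)"
      using e[of t] r ab mult_left_mono[of e "F t - z t" "r t"]
      by (simp add: rate_function_def mult.commute)
    then show "\<exists>D\<ge>e * r t. (z has_real_derivative D) (at t)" using N(2) t ab by auto
  qed (fact ab)
  then show ?thesis by simp
qed

text \<open>
  Close to \<open>b\<close> the mass of \<open>r\<close> is at most \<open>1/2\<close>, so starting from a maximum of \<open>z\<close> near \<open>b\<close>
  at most half of the distance to \<open>c\<close> can be lost.
\<close>

lemma relaxation_barrier_below:
  assumes rel: "relaxation r F z" and r: "rate_function r" and T: "0 \<le> T" "T < b"
    and z: "\<And>t. T \<le> t \<Longrightarrow> t < b \<Longrightarrow> c < z t" and F: "\<And>t. T \<le> t \<Longrightarrow> t < b \<Longrightarrow> c \<le> F t"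
  shows "c < z b"
proof (rule ccontr)
  assume "\<not> c < z b"
  then have zb: "z b \<le> c" by simp
  have "continuous_on {T..b} (\<lambda>s. integral {s..b} r)"
    using rate_function_integrable_on[OF r T(1)] by (rule indefinite_integral_continuous_1')
  then have "((\<lambda>s. integral {s..b} r) \<longlongrightarrow> integral {b..b} r) (at b within {T..b})"
    unfolding continuous_on by (rule bspec) (use T in simp)
  then have "\<forall>\<^sub>F s in at b within {T..b}. integral {s..b} r < 1/2"
    by (rule order_tendstoD) simp
  then obtain d where d: "d > 0" "\<And>s. s \<in> {T..b} \<Longrightarrow> s \<noteq> b \<Longrightarrow> dist s b < d \<Longrightarrow> integral {s..b} r < 1/2"
    unfolding eventually_at by blast
  define a where "a = max T (b - d / 2)"
  have a: "T \<le> a" "a < b" "b - a < d" using d T by (auto simp: a_def)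
  have "continuous_on {a..b} z" using relaxation_continuous_on[OF rel] a T by simp
  then obtain s where s: "s \<in> {a..b}" "\<And>t. t \<in> {a..b} \<Longrightarrow> z t \<le> z s"
    using continuous_attains_sup[of "{a..b}" z] a by auto
  have zs: "z s > c" using s(2)[of a] z[of a] a by simp
  then have sb: "s < b" using s(1) zb by (cases "s = b") auto
  have "(c - z s) * integral {s..b} r \<le> z b - z s"
  proof (rule relaxation_increment_ge[OF rel r])
    fix t assume "s < t" "t < b"
    then show "c - z s \<le> F t - z t" using F[of t] s(2)[of t] s(1) a by simp
  qed (use s T a sb in auto)
  moreover have "(c - z s) * (1/2) \<le> (c - z s) * integral {s..b} r"
    using d(2)[of s] s(1) a sb zs by (intro mult_left_mono_neg) (auto simp: dist_real_def less_imp_le)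
  ultimately show False using zs zb by argo
qed

lemma relaxation_barrier_above:
  assumes "relaxation r F z" "rate_function r" "0 \<le> T" "T < b"
    "\<And>t. T \<le> t \<Longrightarrow> t < b \<Longrightarrow> z t < c" "\<And>t. T \<le> t \<Longrightarrow> t < b \<Longrightarrow> F t \<le> c"
  shows "z b < c"
  using relaxation_barrier_below[OF relaxation_uminus[OF assms(1)] assms(2-4), of "- c"] assms(5,6) by simp

text \<open>While \<open>z\<close> is below \<open>d\<close>, the gap \<open>F - z\<close> is at
  least \<open>c - d\<close>, and the divergent mass of \<open>r\<close> drives \<open>z\<close> up
  to \<open>d\<close>. Afterwards \<open>z\<close> cannot drop below \<open>d\<close>, since it does
  not decrease in total over any stretch spent below \<open>d\<close>.\<close>

lemma relaxation_attracts_below: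
  assumes rel: "relaxation r F z" and r: "rate_function r"
    and F: "\<forall>\<^sub>F t in at_top. c \<le> F t" and d: "d < c"
  shows "\<forall>\<^sub>F t in at_top. d \<le> z t"
proof -
  obtain T0 where T0: "\<And>t. t \<ge> T0 \<Longrightarrow> c \<le> F t" using F unfolding eventually_at_top_linorder by blast
  define T where "T = max T0 0"
  have T: "T \<ge> 0" "\<And>t. t \<ge> T \<Longrightarrow> c \<le> F t" using T0 by (auto simp: T_def)
  have "\<exists>t0\<ge>T. d \<le> z t0"
  proof (rule ccontr)
    assume "\<not> ?thesis"
    then have less: "z t < d" if "t \<ge> T" for t using that by force
    \<comment> \<open>The mass of \<open>r\<close> up to \<open>b\<close> is large enough for a gain
      of \<open>d - z T\<close>, which lifts \<open>z b\<close> to at least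
      \<open>d\<close>.\<close>
    obtain b where b: "b \<ge> T" "integral {T..b} r \<ge> (d - z T) / (c - d)"
      using rate_function_integral_unbounded[OF r T(1)] by blast
    have "(c - d) * integral {T..b} r \<le> z b - z T"
    proof (rule relaxation_increment_ge[OF rel r T(1) b(1)])
      fix t assume "T < t"
      then show "c - d \<le> F t - z t" using T(2)[of t] less[of t] by simp
    qed
    moreover have "d - z T \<le> (c - d) * integral {T..b} r"
      using b(2) d by (simp add: pos_divide_le_eq mult.commute)
    ultimately show False using less[of b] b(1) by simp
  qed
  then obtain t0 where t0: "t0 \<ge> T" "d \<le> z t0" by blast
  have "d \<le> z t" if t: "t \<ge> t0" for t
  proof (rule ccontr)
    assume neg: "\<not> d \<le> z t"
    have cont: "continuous_on {t0..t} z" using relaxation_continuous_on[OF rel] t0 T by simp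
    \<comment> \<open>The greatest element \<open>s\<close> of this compact set is the last time up
      to \<open>t\<close> at which \<open>z\<close> is at least \<open>d\<close>; after it
      \<open>z\<close> stays below \<open>d\<close>.\<close>
    let ?S = "{s \<in> {t0..t}. d \<le> z s}"
    have "closed ?S"
      using continuous_closed_preimage[OF cont closed_atLeastAtMost, of "{d..}"]
      by (simp add: vimage_def Int_def)
    then have "compact ?S"
      by (rule compact_Int_closed[of "{t0..t}" ?S, OF compact_Icc, THEN back_subst[of compact]]) auto
    moreover have "?S \<noteq> {}" using t0 t by auto
    ultimately obtain s where s: "s \<in> ?S" "\<And>s'. s' \<in> ?S \<Longrightarrow> s' \<le> s"
      using compact_attains_sup[of ?S] by blast
    have "(c - d) * integral {s..t} r \<le> z t - z s"
    proof (rule relaxation_increment_ge[OF rel r])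
      fix u assume u: "s < u" "u < t"
      then have "z u < d" using s(2)[of u] s(1) by force
      then show "c - d \<le> F u - z u" using T(2)[of u] u s(1) t0 by simp
    qed (use s t0 T in auto)
    moreover have "0 \<le> integral {s..t} r"
      using r s(1) t0 T by (intro integral_nonneg rate_function_integrable_on[OF r]) (auto simp: rate_function_def)
    then have "0 \<le> (c - d) * integral {s..t} r" using d by simp
    ultimately show False using s(1) neg by simp
  qed
  then show ?thesis unfolding eventually_at_top_linorder by blast
qed

lemma relaxation_attracts_above:
  assumes "relaxation r F z" "rate_function r" "\<forall>\<^sub>F t in at_top. F t \<le> c" "c < d"
  shows "\<forall>\<^sub>F t in at_top. z t \<le> d"
  using relaxation_attracts_below[OF relaxation_uminus[OF assms(1)] assms(2), of "- c" "- d"] assms(3,4)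
  by simp

section \<open>The extended inverse\<close>

lemma increasing_nonlinearityD:
  assumes "increasing_nonlinearity f"
  shows "0 \<le> x \<Longrightarrow> 0 \<le> f x" "0 < x \<Longrightarrow> 0 < f x"
    "0 \<le> x \<Longrightarrow> x < y \<Longrightarrow> f x < f y" "0 \<le> x \<Longrightarrow> x \<le> y \<Longrightarrow> f x \<le> f y"
    "0 < x \<Longrightarrow> isCont f x"
proof -
  have f: "f ` {0..} \<subseteq> {0..}" "continuous_on {0..} f" "strict_mono_on {0..} f" "\<forall>x>0. f x > 0"
    using assms by (auto simp: increasing_nonlinearity_def)
  show "0 \<le> x \<Longrightarrow> 0 \<le> f x" "0 < x \<Longrightarrow> 0 < f x" using f by auto
  show "0 \<le> x \<Longrightarrow> x < y \<Longrightarrow> f x < f y" using f(3) by (simp add: strict_mono_on_def)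
  then show "0 \<le> x \<Longrightarrow> x \<le> y \<Longrightarrow> f x \<le> f y" by (cases "x = y") auto
  show "isCont f x" if "0 < x"
  proof (rule continuous_on_interior)
    show "x \<in> interior {0..}" using that by simp
  qed (fact f(2))
qed

text \<open>A value below \<open>w\<close> is not infinite, so \<open>z\<close> is either below
  \<open>f 0\<close> or in the range of \<open>f\<close>, where the inverse preserves the
  order.\<close>

lemma ext_inverse_lessD:
  assumes f: "increasing_nonlinearity f" and less: "ext_inverse f z < ereal w" and w: "0 < w"
  shows "z < f w"
proof (cases "z < f 0")
  case True
  also have "f 0 < f w" using increasing_nonlinearityD(3)[OF f, of 0 w] w by simp
  finally show ?thesis .
next
  case False
  then have z: "z \<in> f ` {0..}" "the_inv_into {0..} f z < w"
    using less by (auto simp: ext_inverse_def split: if_splits)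
  have inj: "inj_on f {0..}"
    using f by (simp add: increasing_nonlinearity_def strict_mono_on_imp_inj_on)
  obtain v where "v \<ge> 0" "z = f v" using z(1) by auto
  moreover have "v < w" using z(2) inj calculation by (simp add: the_inv_into_f_f)
  ultimately show ?thesis using increasing_nonlinearityD(3)[OF f] by simp
qed

text \<open>The default value \<open>0\<close> cannot exceed \<open>w \<ge> 0\<close>, hence
  \<open>f 0 \<le> z\<close>. If also \<open>z \<le> f w\<close>, the intermediate value theorem
  puts \<open>z\<close> into the range with a preimage at most \<open>w\<close>. The value
  \<open>\<infinity>\<close> is thereby covered too.\<close>

lemma less_ext_inverseD:
  assumes f: "increasing_nonlinearity f" and less: "ereal w < ext_inverse f z" and w: "0 \<le> w"
  shows "f w < z"
proof (rule ccontr)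
  assume "\<not> f w < z"
  then have zw: "z \<le> f w" by simp
  have z0: "f 0 \<le> z" using less w by (auto simp: ext_inverse_def zero_ereal_def split: if_splits)
  have "continuous_on {0..w} f"
    using f continuous_on_subset[of "{0..}" f "{0..w}"] by (auto simp: increasing_nonlinearity_def)
  then obtain v where v: "0 \<le> v" "v \<le> w" "f v = z" using IVT'[of f 0 z w] z0 zw w by auto
  have inj: "inj_on f {0..}"
    using f by (simp add: increasing_nonlinearity_def strict_mono_on_imp_inj_on)
  have "ext_inverse f z = ereal v"
    using v z0 inj the_inv_into_f_f[of f "{0..}" v] by (auto simp: ext_inverse_def)
  then show False using less v by simp
qed

section \<open>Delayed relaxation\<close>

text \<open>One component \<open>u\<close> of the system, with the other component \<open>v\<close>
  as its delayed input. The system is two such relations with \<open>x\<close> and \<open>y\<close>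
  exchanged, so each estimate is proved once.\<close>

definition delayed_relaxation ::
    "(real \<Rightarrow> real) \<Rightarrow> (real \<Rightarrow> real) \<Rightarrow> (real \<Rightarrow> real \<Rightarrow> real) \<Rightarrow> (real \<Rightarrow> real) \<Rightarrow>
     (real \<Rightarrow> real) \<Rightarrow> (real \<Rightarrow> real) \<Rightarrow> bool" where
  "delayed_relaxation f h R r v u \<longleftrightarrow>
     increasing_nonlinearity f \<and> delay_function h \<and> delay_kernel h R \<and> rate_function r \<and>
     continuous_on UNIV v \<and>
     relaxation r (\<lambda>t. stieltjes_integral (h t) t (\<lambda>s. f (v s)) (R t)) u"

lemma delayed_average_bounds:
  assumes dr: "delayed_relaxation f h R r v u" and t: "0 \<le> t"
    and nonneg: "\<And>s. s \<in> {h t..t} \<Longrightarrow> 0 \<le> v s"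
  shows "\<lbrakk>0 \<le> l; \<And>s. s \<in> {h t..t} \<Longrightarrow> l \<le> v s\<rbrakk> \<Longrightarrow>
      f l \<le> stieltjes_integral (h t) t (\<lambda>s. f (v s)) (R t)"
    and "(\<And>s. s \<in> {h t..t} \<Longrightarrow> v s \<le> m) \<Longrightarrow>
      stieltjes_integral (h t) t (\<lambda>s. f (v s)) (R t) \<le> f m"
proof -
  have f: "increasing_nonlinearity f" and ht: "h t \<le> t"
    using dr t by (auto simp: delayed_relaxation_def delay_function_def)
  have R: "mono (R t)" "\<And>s. s \<le> h t \<Longrightarrow> R t s = 0" "(R t \<longlongrightarrow> 1) (at_right t)"
    using dr t by (auto simp: delayed_relaxation_def delay_kernel_def)
  have cv: "continuous_on {h t..t} v"
    using dr continuous_on_subset[of UNIV v] by (simp add: delayed_relaxation_def)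
  have cont: "continuous_on {h t..t} (\<lambda>s. f (v s))"
    by (rule continuous_on_compose2[of "{0..}" f, OF _ cv])
      (use f nonneg in \<open>auto simp: increasing_nonlinearity_def\<close>)
  \<comment> \<open>Extrema of \<open>f (v s)\<close> are attained on the window; comparing
    \<open>l\<close> and \<open>m\<close> with \<open>v\<close> at these points stays inside the
    domain on which \<open>f\<close> is monotone.\<close>
  obtain a where a: "a \<in> {h t..t}" "\<And>s. s \<in> {h t..t} \<Longrightarrow> f (v a) \<le> f (v s)"
    using continuous_attains_inf[OF _ _ cont] ht by auto
  obtain b where b: "b \<in> {h t..t}" "\<And>s. s \<in> {h t..t} \<Longrightarrow> f (v s) \<le> f (v b)"
    using continuous_attains_sup[OF _ _ cont] ht by auto
  have bounds: "f (v a) \<le> stieltjes_integral (h t) t (\<lambda>s. f (v s)) (R t)"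
    "stieltjes_integral (h t) t (\<lambda>s. f (v s)) (R t) \<le> f (v b)"
    using stieltjes_integral_bounds[OF R ht cont] a(2) b(2) by auto
  show "f l \<le> stieltjes_integral (h t) t (\<lambda>s. f (v s)) (R t)"
    if "0 \<le> l" "\<And>s. s \<in> {h t..t} \<Longrightarrow> l \<le> v s"
    using increasing_nonlinearityD(4)[OF f, of l "v a"] that a(1) bounds(1) by force
  show "stieltjes_integral (h t) t (\<lambda>s. f (v s)) (R t) \<le> f m"
    if "\<And>s. s \<in> {h t..t} \<Longrightarrow> v s \<le> m"
    using increasing_nonlinearityD(4)[OF f, of "v b" m] that[of b] nonneg[of b] b(1) bounds(2) by force
qed

text \<open>The box conditions place the average of \<open>f (v s)\<close> between \<open>l\<close>
  and \<open>m\<close>, so neither barrier can be reached at time \<open>b\<close>.\<close>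

lemma delayed_relaxation_barrier:
  assumes dr: "delayed_relaxation f h R r v u" and T: "0 \<le> T" "T < b"
    and u: "\<And>t. T \<le> t \<Longrightarrow> t < b \<Longrightarrow> l < u t \<and> u t < m"
    and v: "\<And>t s. T \<le> t \<Longrightarrow> t < b \<Longrightarrow> s \<in> {h t..t} \<Longrightarrow> l' \<le> v s \<and> v s \<le> m'"
    and box: "0 \<le> l'" "l \<le> f l'" "f m' \<le> m"
  shows "l < u b \<and> u b < m"
proof -
  let ?F = "\<lambda>t. stieltjes_integral (h t) t (\<lambda>s. f (v s)) (R t)"
  have rel: "relaxation r ?F u" and r: "rate_function r"
    using dr by (auto simp: delayed_relaxation_def)
  have F: "l \<le> ?F t" "?F t \<le> m" if t: "T \<le> t" "t < b" for t
  proof -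
    have nonneg: "0 \<le> v s" if "s \<in> {h t..t}" for s using v[OF t that] box(1) by simp
    have t0: "0 \<le> t" using t T by simp
    show "l \<le> ?F t"
      using delayed_average_bounds(1)[OF dr t0 nonneg box(1)] v[OF t] box(2) by force
    show "?F t \<le> m"
      using delayed_average_bounds(2)[OF dr t0 nonneg, of m'] v[OF t] box(3) by force
  qed
  show ?thesis
    using relaxation_barrier_below[OF rel r T, of l] relaxation_barrier_above[OF rel r T, of m] u F
    by blast
qed

text \<open>Since \<open>h\<close> tends to infinity, the window \<open>{h t..t}\<close> eventually
  lies where the bound on \<open>v\<close> holds. The forcing is then bounded by the image of that
  bound under \<open>f\<close>, and relaxation passes it on to \<open>u\<close> with an arbitrarily
  small loss.\<close>

lemma delayed_relaxation_attracts:
  assumes dr: "delayed_relaxation f h R r v u" and nonneg: "\<And>s. 0 \<le> v s"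
  shows "\<lbrakk>0 \<le> l; \<forall>\<^sub>F t in at_top. l \<le> v t; d < f l\<rbrakk> \<Longrightarrow> \<forall>\<^sub>F t in at_top. d \<le> u t"
    and "\<lbrakk>\<forall>\<^sub>F t in at_top. v t \<le> m; f m < e\<rbrakk> \<Longrightarrow> \<forall>\<^sub>F t in at_top. u t \<le> e"
proof -
  let ?F = "\<lambda>t. stieltjes_integral (h t) t (\<lambda>s. f (v s)) (R t)"
  have rel: "relaxation r ?F u" and r: "rate_function r" and h: "filterlim h at_top at_top"
    using dr by (auto simp: delayed_relaxation_def delay_function_def)
  have late: "\<forall>\<^sub>F t in at_top. 0 \<le> t \<and> S \<le> h t" for S
    using h by (intro eventually_conj eventually_ge_at_top) (simp add: filterlim_at_top)
  show "\<forall>\<^sub>F t in at_top. d \<le> u t" if l: "0 \<le> l" "\<forall>\<^sub>F t in at_top. l \<le> v t" "d < f l"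
  proof (rule relaxation_attracts_below[OF rel r _ l(3)])
    obtain S where S: "\<And>s. s \<ge> S \<Longrightarrow> l \<le> v s" using l(2) unfolding eventually_at_top_linorder by blast
    show "\<forall>\<^sub>F t in at_top. f l \<le> ?F t"
      using late[of S]
    proof (rule eventually_mono)
      fix t assume "0 \<le> t \<and> S \<le> h t"
      then show "f l \<le> ?F t"
        using S by (intro delayed_average_bounds(1)[OF dr] nonneg l(1)) auto
    qed
  qed
  show "\<forall>\<^sub>F t in at_top. u t \<le> e" if m: "\<forall>\<^sub>F t in at_top. v t \<le> m" "f m < e"
  proof (rule relaxation_attracts_above[OF rel r _ m(2)])
    obtain S where S: "\<And>s. s \<ge> S \<Longrightarrow> v s \<le> m" using m(1) unfolding eventually_at_top_linorder by blast
    show "\<forall>\<^sub>F t in at_top. ?F t \<le> f m"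
      using late[of S]
    proof (rule eventually_mono)
      fix t assume "0 \<le> t \<and> S \<le> h t"
      then show "?F t \<le> f m"
        using S by (intro delayed_average_bounds(2)[OF dr] nonneg) auto
    qed
  qed
qed

text \<open>First exit argument. The open box makes the set of exit times closed, so a first exit
  time \<open>b\<close> exists. Before \<open>b\<close> both inputs lie in the closed box, the part
  of the windows before \<open>T\<close> by the \<open>past\<close> hypotheses, and the barriers
  keep both components strictly inside at \<open>b\<close>.\<close>

lemma invariant_box:
  assumes x: "delayed_relaxation f\<^sub>1 h\<^sub>1 R\<^sub>1 r\<^sub>1 y x" and y: "delayed_relaxation f\<^sub>2 h\<^sub>2 R\<^sub>2 r\<^sub>2 x y"
    and T: "0 \<le> T"
    and init: "p < x T" "x T < P" "q < y T" "y T < Q"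
    and past_y: "\<And>t s. T \<le> t \<Longrightarrow> h\<^sub>1 t \<le> s \<Longrightarrow> s \<le> T \<Longrightarrow> q \<le> y s \<and> y s \<le> Q"
    and past_x: "\<And>t s. T \<le> t \<Longrightarrow> h\<^sub>2 t \<le> s \<Longrightarrow> s \<le> T \<Longrightarrow> p \<le> x s \<and> x s \<le> P"
    and box: "0 \<le> p" "0 \<le> q" "p \<le> f\<^sub>1 q" "f\<^sub>1 Q \<le> P" "q \<le> f\<^sub>2 p" "f\<^sub>2 P \<le> Q"
    and t: "T \<le> t"
  shows "p < x t \<and> x t < P \<and> q < y t \<and> y t < Q"
proof (rule ccontr)
  let ?U = "{p<..<P} \<times> {q<..<Q}"
  assume neg: "\<not> ?thesis"
  have cont: "continuous_on {T..t} (\<lambda>t. (x t, y t))"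
    using x y unfolding delayed_relaxation_def
    by (intro continuous_on_Pair) (auto intro: continuous_on_subset)
  let ?S = "{T..t} \<inter> (\<lambda>t. (x t, y t)) -` (- ?U)"
  have "closed ?S"
    by (intro continuous_closed_preimage[OF cont]) (auto intro!: closed_Compl open_Times)
  then have "compact ({T..t} \<inter> ?S)" by (intro compact_Int_closed compact_Icc)
  then have "compact ?S" by (simp add: Int_absorb1)
  moreover have "?S \<noteq> {}" using neg t by auto
  ultimately obtain b where b: "b \<in> ?S" "\<And>s. s \<in> ?S \<Longrightarrow> b \<le> s"
    using compact_attains_inf[of ?S] by blast
  have "b \<noteq> T" using b(1) init by auto
  then have Tb: "T < b" using b(1) by auto
  have inside: "p < x s \<and> x s < P" "q < y s \<and> y s < Q" if s: "T \<le> s" "s < b" for s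
    using b(2)[of s] b(1) s by auto
  have "p < x b \<and> x b < P"
  proof (rule delayed_relaxation_barrier[OF x T Tb inside(1) _ box(2-4)])
    fix t s assume ts: "T \<le> t" "t < b" "s \<in> {h\<^sub>1 t..t}"
    then show "q \<le> y s \<and> y s \<le> Q"
      using past_y[OF ts(1), of s] inside(2)[of s] by (cases "s \<le> T") auto
  qed auto
  moreover have "q < y b \<and> y b < Q"
  proof (rule delayed_relaxation_barrier[OF y T Tb inside(2) _ box(1,5,6)])
    fix t s assume ts: "T \<le> t" "t < b" "s \<in> {h\<^sub>2 t..t}"
    then show "p \<le> x s \<and> x s \<le> P"
      using past_x[OF ts(1), of s] inside(1)[of s] by (cases "s \<le> T") auto
  qed auto
  ultimately show False using b(1) by auto
qed

text \<open>Let \<open>a\<close> be the supremum of the asymptotic lower bounds. If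
  \<open>a < K\<close>, then \<open>a < g a\<close>, and continuity gives a bound \<open>c\<close>
  near \<open>a\<close> with \<open>g c\<close> above some \<open>m > a\<close>;
  \<open>improve\<close> then makes \<open>m\<close> a lower bound as well.\<close>

lemma eventually_ge_below_fixpoint:
  fixes x g :: "real \<Rightarrow> real"
  assumes p: "0 < p" "\<forall>\<^sub>F t in at_top. p \<le> x t" and B: "\<And>t. 0 \<le> t \<Longrightarrow> x t \<le> B"
    and g: "\<And>z. 0 < z \<Longrightarrow> z < K \<Longrightarrow> z < g z" "\<And>z. 0 < z \<Longrightarrow> isCont g z"
    and improve: "\<And>c d. 0 < c \<Longrightarrow> \<forall>\<^sub>F t in at_top. c \<le> x t \<Longrightarrow> d < g c \<Longrightarrow> \<forall>\<^sub>F t in at_top. d \<le> x t"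
    and c: "c < K"
  shows "\<forall>\<^sub>F t in at_top. c \<le> x t"
proof -
  define S where "S = {c. \<forall>\<^sub>F t in at_top. c \<le> x t}"
  have "c \<le> B" if "c \<in> S" for c
  proof -
    have "\<forall>\<^sub>F t in at_top. c \<le> x t \<and> 0 \<le> t"
      using that by (auto simp: S_def intro: eventually_conj eventually_ge_at_top)
    then obtain t where "c \<le> x t" "0 \<le> t" by (auto simp: eventually_at_top_linorder)
    then show ?thesis using B[of t] by simp
  qed
  then have bdd: "bdd_above S" by (auto simp: bdd_above_def)
  have pS: "p \<in> S" using p by (simp add: S_def)
  define a where "a = Sup S"
  have upper: "c \<le> a" if "c \<in> S" for c using that bdd by (auto simp: a_def cSup_upper)
  have "K \<le> a"
  proof (rule ccontr)
    assume "\<not> K \<le> a"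
    moreover have a0: "0 < a" using upper[OF pS] p by simp
    ultimately have "a < g a" using g by simp
    then obtain m where m: "a < m" "m < g a" using dense by blast
    have "\<forall>\<^sub>F z in at a. m < g z"
      using g(2)[OF a0] m(2) by (intro order_tendstoD(1)[of g "g a"]) (auto simp: isCont_def)
    then obtain d where d: "d > 0" "\<And>z. z \<noteq> a \<Longrightarrow> dist z a < d \<Longrightarrow> m < g z"
      unfolding eventually_at by auto
    \<comment> \<open>The maximum with \<open>0\<close> makes \<open>c\<close> positive, as
      \<open>improve\<close> requires.\<close>
    have "max 0 (a - d) < Sup S" using a0 d unfolding a_def by simp
    then obtain c where c: "c \<in> S" "max 0 (a - d) < c" using less_cSupE[of _ S] pS by blast
    have "m < g c"
      using d(2)[of c] m c upper[OF c(1)] by (cases "c = a") (auto simp: dist_real_def)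
    then have "m \<in> S" using improve[of c m] c by (simp add: S_def)
    then show False using upper[of m] m by simp
  qed
  then have "c < Sup S" using c by (simp add: a_def)
  then obtain c' where "c' \<in> S" "c < c'" using less_cSupE[of _ S] pS by blast
  then show ?thesis by (auto simp: S_def elim!: eventually_mono)
qed

text \<open>The dual argument with the infimum of the asymptotic upper bounds. Here every bound
  \<open>c\<close> is positive because it is at least \<open>a > K\<close>.\<close>

lemma eventually_le_above_fixpoint:
  fixes x g :: "real \<Rightarrow> real"
  assumes B: "\<forall>\<^sub>F t in at_top. x t \<le> B" and x: "\<And>t. 0 \<le> x t" and K: "0 < K"
    and g: "\<And>z. K < z \<Longrightarrow> g z < z" "\<And>z. 0 < z \<Longrightarrow> isCont g z"
    and improve: "\<And>c d. 0 < c \<Longrightarrow> \<forall>\<^sub>F t in at_top. x t \<le> c \<Longrightarrow> g c < d \<Longrightarrow> \<forall>\<^sub>F t in at_top. x t \<le> d"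
    and c: "K < c"
  shows "\<forall>\<^sub>F t in at_top. x t \<le> c"
proof -
  define S where "S = {c. \<forall>\<^sub>F t in at_top. x t \<le> c}"
  have "0 \<le> c" if "c \<in> S" for c
  proof -
    obtain t where "x t \<le> c" using \<open>c \<in> S\<close> by (auto simp: S_def eventually_at_top_linorder)
    then show ?thesis using x[of t] by simp
  qed
  then have bdd: "bdd_below S" by (auto simp: bdd_below_def)
  have BS: "B \<in> S" using B by (simp add: S_def)
  define a where "a = Inf S"
  have lower: "a \<le> c" if "c \<in> S" for c using that bdd by (auto simp: a_def cInf_lower)
  have "a \<le> K"
  proof (rule ccontr)
    assume "\<not> a \<le> K"
    then have a0: "K < a" by simp
    then have "g a < a" using g by simp
    then obtain m where m: "g a < m" "m < a" using dense by blast
    have "\<forall>\<^sub>F z in at a. g z < m"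
      using g(2)[of a] a0 K m(1) by (intro order_tendstoD(2)[of g "g a"]) (auto simp: isCont_def)
    then obtain d where d: "d > 0" "\<And>z. z \<noteq> a \<Longrightarrow> dist z a < d \<Longrightarrow> g z < m"
      unfolding eventually_at by auto
    have "Inf S < a + d" using d unfolding a_def by simp
    then obtain c where c: "c \<in> S" "c < a + d" using cInf_lessD[of S] BS by blast
    have "g c < m"
      using d(2)[of c] m c lower[OF c(1)] by (cases "c = a") (auto simp: dist_real_def)
    then have "m \<in> S" using improve[of c m] c lower[OF c(1)] a0 K by (simp add: S_def)
    then show False using lower[of m] m by simp
  qed
  then have "Inf S < c" using c by (simp add: a_def)
  then obtain c' where "c' \<in> S" "c' < c" using cInf_lessD[of S] BS by blast
  then show ?thesis by (auto simp: S_def elim!: eventually_mono)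
qed

text \<open>Attraction reaches only levels strictly below its target. Continuity supplies an
  intermediate level \<open>w\<close> with room on both sides; positivity keeps it in the domain of
  the nonlinearities.\<close>

lemma isCont_less_left:
  fixes f :: "real \<Rightarrow> real"
  assumes "isCont f a" "0 < a" "d < f a"
  obtains w where "0 < w" "w < a" "d < f w"
proof -
  have "(f \<longlongrightarrow> f a) (at_left a)"
    using assms(1) by (simp add: isCont_def filterlim_at_split)
  then have "\<forall>\<^sub>F w in at_left a. d < f w"
    using assms(3) by (rule order_tendstoD)
  moreover have "\<forall>\<^sub>F w in at_left a. w \<in> {0<..<a}"
    using assms(2) by (rule eventually_at_leftI[rotated]) auto
  ultimately have "\<forall>\<^sub>F w in at_left a. d < f w \<and> w \<in> {0<..<a}"
    by (rule eventually_conj)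
  then show thesis
    using that eventually_happens'[OF trivial_limit_at_left_real] by force
qed

lemma isCont_greater_right:
  fixes f :: "real \<Rightarrow> real"
  assumes "isCont f a" "f a < d"
  obtains w where "a < w" "f w < d"
proof -
  have "(f \<longlongrightarrow> f a) (at_right a)"
    using assms(1) by (simp add: isCont_def filterlim_at_split)
  then have "\<forall>\<^sub>F w in at_right a. f w < d"
    using assms(2) by (rule order_tendstoD)
  then have "\<forall>\<^sub>F w in at_right a. f w < d \<and> a < w"
    using eventually_at_right_less by (rule eventually_conj)
  then show thesis
    using that eventually_happens'[OF trivial_limit_at_right_real] by force
qed

text \<open>Delayed arguments may reach into the initial history, so continuity is needed across
  \<open>0\<close>, where the two continuous pieces share their value.\<close>

lemma continuous_on_UNIV_of_history:
  assumes z: "locally_abs_continuous z" and \<theta>: "initial_function \<theta>"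
    and eq: "\<And>t. t \<le> 0 \<Longrightarrow> z t = \<theta> t"
  shows "continuous_on UNIV z"
proof -
  have "isCont z t" for t
  proof (rule continuous_on_interior)
    define b where "b = max t 0 + 1"
    have "continuous_on {..0} z"
      using \<theta> eq by (subst continuous_on_cong[of _ "{..0}" z \<theta>]) (auto simp: initial_function_def)
    moreover have "continuous_on {0..b} z"
      using z by (intro abs_continuous_on_imp_continuous_on) (auto simp: locally_abs_continuous_def b_def)
    ultimately have "continuous_on ({..0} \<union> {0..b}) z"
      by (intro continuous_on_closed_Un) auto
    then show "continuous_on {..b} z"
      by (rule continuous_on_subset) auto
    show "t \<in> interior {..b}" by (auto simp: b_def)
  qed
  then show ?thesis by (simp add: continuous_at_imp_continuous_on)
qed

lemma initial_function_bounds: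
  assumes \<theta>: "initial_function \<theta>"
  obtains B where "B > 0" "\<And>t. t \<le> 0 \<Longrightarrow> 0 \<le> \<theta> t \<and> \<theta> t \<le> B"
proof -
  have "bounded (\<theta> ` {..0})" using \<theta> by (simp add: initial_function_def)
  then obtain B where B: "B > 0" "\<forall>v\<in>\<theta> ` {..0}. norm v \<le> B"
    unfolding bounded_pos by blast
  have "0 \<le> \<theta> t \<and> \<theta> t \<le> B" if "t \<le> 0" for t
  proof
    show "0 \<le> \<theta> t"
      using \<theta> that by (cases "t = 0") (auto simp: initial_function_def)
    have "norm (\<theta> t) \<le> B" using B(2) that by blast
    then show "\<theta> t \<le> B" by simp
  qed
  then show thesis using that B(1) by blast
qed

section \<open>Global attraction\<close>

theorem theorem3p1:
  fixes f\<^sub>1 f\<^sub>2 h\<^sub>1 h\<^sub>2 r\<^sub>1 r\<^sub>2 \<phi> \<psi> x y :: "real \<Rightarrow> real"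
    and R\<^sub>1 R\<^sub>2 :: "real \<Rightarrow> real \<Rightarrow> real"
    and K :: real
  assumes "increasing_nonlinearity f\<^sub>1" and "increasing_nonlinearity f\<^sub>2"
    and "K > 0" and "ext_inverse f\<^sub>1 K = ereal (f\<^sub>2 K)"
    and "\<forall>z>0. ext_inverse f\<^sub>1 z = ereal (f\<^sub>2 z) \<longrightarrow> z = K"
    and "\<forall>z. f\<^sub>1 0 < z \<and> z < K \<longrightarrow> ereal (f\<^sub>2 z) > ext_inverse f\<^sub>1 z"
    and "\<forall>z>K. ereal (f\<^sub>2 z) < ext_inverse f\<^sub>1 z"
    and "delay_function h\<^sub>1" and "delay_function h\<^sub>2"
    and "delay_kernel h\<^sub>1 R\<^sub>1" and "delay_kernel h\<^sub>2 R\<^sub>2"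
    and "rate_function r\<^sub>1" and "rate_function r\<^sub>2"
    and "initial_function \<phi>" and "initial_function \<psi>"
    and "solution_P f\<^sub>1 f\<^sub>2 h\<^sub>1 h\<^sub>2 R\<^sub>1 R\<^sub>2 r\<^sub>1 r\<^sub>2 \<phi> \<psi> x y"
  shows "((\<lambda>t. (x t, y t)) \<longlongrightarrow> (K, f\<^sub>2 K)) at_top"
proof -
  note f1 = increasing_nonlinearityD[OF assms(1)]
  note f2 = increasing_nonlinearityD[OF assms(2)]
  have K: "0 < K" by fact

  \<comment> \<open>Comparison of the composed map with the diagonal\<close>
  let ?g = "\<lambda>z. f\<^sub>1 (f\<^sub>2 z)"
  have above: "?g z < z" if "K < z" for z
    using less_ext_inverseD[OF assms(1)] assms(7) f2(1)[of z] that K by simp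
  have below: "z < ?g z" if z: "0 < z" "z < K" for z
  proof (cases "f\<^sub>1 0 < z")
    case True
    then show ?thesis using ext_inverse_lessD[OF assms(1)] assms(6) f2(2)[of z] z by simp
  next
    \<comment> \<open>Here \<open>z \<le> f\<^sub>1 0\<close>, and
      \<open>f\<^sub>1 0 < f\<^sub>1 (f\<^sub>2 z)\<close> because \<open>f\<^sub>2 z\<close> is
      positive.\<close>
    case False
    then show ?thesis using f1(3)[of 0 "f\<^sub>2 z"] f2(2)[of z] z by simp
  qed
  have contg: "isCont ?g z" if "0 < z" for z
    using isCont_o2[of z f\<^sub>2 f\<^sub>1] f1(5) f2(5) f2(2) that by simp

  \<comment> \<open>Reduction to two delayed relaxations\<close>
  have hist: "\<And>t. t \<le> 0 \<Longrightarrow> x t = \<phi> t" "\<And>t. t \<le> 0 \<Longrightarrow> y t = \<psi> t"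
    using assms(16) by (auto simp: solution_P_def)
  have cx: "continuous_on UNIV x"
    by (rule continuous_on_UNIV_of_history[OF _ assms(14) hist(1)]) (use assms(16) in \<open>auto simp: solution_P_def\<close>)
  have cy: "continuous_on UNIV y"
    by (rule continuous_on_UNIV_of_history[OF _ assms(15) hist(2)]) (use assms(16) in \<open>auto simp: solution_P_def\<close>)
  have sol: "AE t in lebesgue_on {0..}.
      (x has_real_derivative r\<^sub>1 t * (stieltjes_integral (h\<^sub>1 t) t (\<lambda>s. f\<^sub>1 (y s)) (R\<^sub>1 t) - x t)) (at t) \<and>
      (y has_real_derivative r\<^sub>2 t * (stieltjes_integral (h\<^sub>2 t) t (\<lambda>s. f\<^sub>2 (x s)) (R\<^sub>2 t) - y t)) (at t)"
    using assms(16) by (simp add: solution_P_def)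
  have X: "delayed_relaxation f\<^sub>1 h\<^sub>1 R\<^sub>1 r\<^sub>1 y x"
    unfolding delayed_relaxation_def relaxation_def
    by (intro conjI assms cy eventually_mono[OF sol]) (use assms(16) in \<open>auto simp: solution_P_def\<close>)
  have Y: "delayed_relaxation f\<^sub>2 h\<^sub>2 R\<^sub>2 r\<^sub>2 x y"
    unfolding delayed_relaxation_def relaxation_def
    by (intro conjI assms cx eventually_mono[OF sol]) (use assms(16) in \<open>auto simp: solution_P_def\<close>)

  \<comment> \<open>Boundedness and positivity\<close>
  obtain A where A: "A > 0" "\<And>t. t \<le> 0 \<Longrightarrow> 0 \<le> x t \<and> x t \<le> A"
    by (rule initial_function_bounds[OF assms(14)]) (use hist(1) in auto)
  obtain B where B: "B > 0" "\<And>t. t \<le> 0 \<Longrightarrow> 0 \<le> y t \<and> y t \<le> B"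
    by (rule initial_function_bounds[OF assms(15)]) (use hist(2) in auto)
  have init: "0 < x 0" "0 < y 0"
    using assms(14,15) hist by (auto simp: initial_function_def)
  \<comment> \<open>\<open>P > K\<close> gives \<open>f\<^sub>1 (f\<^sub>2 P) < P\<close>, and
    \<open>P \<ge> f\<^sub>1 (B + 1)\<close> handles the other value of the maximum
    \<open>Q\<close>; together they yield \<open>f\<^sub>1 Q \<le> P\<close>. The summands
    \<open>1\<close> leave the initial data strictly inside.\<close>
  define P where "P = max (K + 1) (max (A + 1) (f\<^sub>1 (B + 1)))"
  define Q where "Q = max (f\<^sub>2 P) (B + 1)"
  have P: "K < P" "A < P" "f\<^sub>1 (B + 1) \<le> P" by (auto simp: P_def)
  have PQ: "f\<^sub>1 Q \<le> P" "f\<^sub>2 P \<le> Q" "B < Q"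
    using above[OF P(1)] P(3) by (auto simp: Q_def max_def)
  have inside: "0 < x t \<and> x t < P \<and> 0 < y t \<and> y t < Q" if "0 \<le> t" for t
  proof (rule invariant_box[OF X Y, of 0])
    show "0 \<le> y s \<and> y s \<le> Q" if "s \<le> 0" for s using B(2)[OF that] PQ by simp
    show "0 \<le> x s \<and> x s \<le> P" if "s \<le> 0" for s using A(2)[OF that] P by simp
    show "x 0 < P" "y 0 < Q" using A(2)[of 0] B(2)[of 0] P PQ by auto
  qed (use init f1(1) f2(1) PQ that in auto)
  have nonneg: "0 \<le> x t" "0 \<le> y t" for t
    using inside[of t] A(2)[of t] B(2)[of t] by (cases "0 \<le> t"; simp)+

  \<comment> \<open>A positive asymptotic lower bound\<close>
  obtain p where p: "0 < p" "\<forall>\<^sub>F t in at_top. p \<le> x t"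
  proof -
    have "\<forall>\<^sub>F t in at_top. 0 \<le> h\<^sub>1 t \<and> 0 \<le> h\<^sub>2 t"
      using assms(8,9) by (auto simp: delay_function_def filterlim_at_top intro: eventually_conj)
    then obtain T0 where T0: "\<And>t. t \<ge> T0 \<Longrightarrow> 0 \<le> h\<^sub>1 t \<and> 0 \<le> h\<^sub>2 t"
      unfolding eventually_at_top_linorder by blast
    \<comment> \<open>The history may vanish before \<open>0\<close>. From \<open>T\<close> on, the
      windows see only times from \<open>0\<close> onwards, where both components are
      positive.\<close>
    define T where "T = max T0 0"
    have T: "0 \<le> T" "\<And>t. t \<ge> T \<Longrightarrow> 0 \<le> h\<^sub>1 t \<and> 0 \<le> h\<^sub>2 t" using T0 by (auto simp: T_def)
    obtain a where a: "0 \<le> a" "\<And>t. t \<in> {0..T} \<Longrightarrow> x a \<le> x t"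
      using continuous_attains_inf[of "{0..T}" x] cx T(1) continuous_on_subset[OF cx] by auto
    obtain b where b: "0 \<le> b" "\<And>t. t \<in> {0..T} \<Longrightarrow> y b \<le> y t"
      using continuous_attains_inf[of "{0..T}" y] cy T(1) continuous_on_subset[OF cy] by auto
    have ab: "0 < x a" "0 < y b" using inside a(1) b(1) by auto
    \<comment> \<open>\<open>p\<close> and \<open>q\<close> lie below the minima of \<open>x\<close>
      and \<open>y\<close> on \<open>{0..T}\<close>. Both candidates for \<open>q\<close> satisfy
      \<open>p \<le> f\<^sub>1 q\<close>: \<open>f\<^sub>2 p\<close> because \<open>p < K\<close>,
      and \<open>y b / 2\<close> by the last entry of \<open>p\<close>.\<close>
    define p where "p = min (min (x a / 2) (K / 2)) (f\<^sub>1 (y b / 2))"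
    define q where "q = min (f\<^sub>2 p) (y b / 2)"
    have p: "0 < p" "p < x a" "p < K" "p \<le> f\<^sub>1 (y b / 2)"
      using ab K f1(2)[of "y b / 2"] by (auto simp: p_def)
    have q: "0 < q" "q < y b" "q \<le> f\<^sub>2 p" "p \<le> f\<^sub>1 q"
      using ab p below[of p] f2(2)[of p] by (auto simp: q_def min_def)
    have "p < x t \<and> x t < P \<and> q < y t \<and> y t < Q" if "T \<le> t" for t
    proof (rule invariant_box[OF X Y T(1)])
      show "q \<le> y s \<and> y s \<le> Q" if "T \<le> t" "h\<^sub>1 t \<le> s" "s \<le> T" for t s
        using T(2)[of t] that b(2)[of s] q inside[of s] by auto
      show "p \<le> x s \<and> x s \<le> P" if "T \<le> t" "h\<^sub>2 t \<le> s" "s \<le> T" for t s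
        using T(2)[of t] that a(2)[of s] p inside[of s] by auto
      show "p < x T" "x T < P" "q < y T" "y T < Q"
        using a(2)[of T] b(2)[of T] p q inside[of T] T(1) by auto
    qed (use p q PQ that in auto)
    then have "\<forall>\<^sub>F t in at_top. p \<le> x t"
      unfolding eventually_at_top_linorder by (intro exI[of _ T]) (auto intro: less_imp_le)
    then show thesis using that p(1) by blast
  qed

  \<comment> \<open>Improvement of the asymptotic bounds up to \<open>K\<close>\<close>
  have lower: "\<forall>\<^sub>F t in at_top. c \<le> x t" if "c < K" for c
  proof (rule eventually_ge_below_fixpoint[OF p _ below contg _ that])
    show "x t \<le> P" if "0 \<le> t" for t using inside[OF that] by simp
    fix c d assume c: "0 < c" "\<forall>\<^sub>F t in at_top. c \<le> x t" and d: "d < ?g c"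
    \<comment> \<open>A bound on \<open>x\<close> travels through \<open>y\<close> and back, with a
      strict loss each time; \<open>w\<close> is the intermediate level for
      \<open>y\<close>.\<close>
    obtain w where w: "0 < w" "w < f\<^sub>2 c" "d < f\<^sub>1 w"
      using isCont_less_left[OF f1(5) _ d] f2(2)[OF c(1)] by blast
    have "\<forall>\<^sub>F t in at_top. w \<le> y t"
      using c w by (intro delayed_relaxation_attracts(1)[OF Y nonneg(1), of c]) auto
    then show "\<forall>\<^sub>F t in at_top. d \<le> x t"
      using w by (intro delayed_relaxation_attracts(1)[OF X nonneg(2), of w]) auto
  qed
  have upper: "\<forall>\<^sub>F t in at_top. x t \<le> c" if "K < c" for c
  proof (rule eventually_le_above_fixpoint[OF _ nonneg(1) K above contg _ that])
    show "\<forall>\<^sub>F t in at_top. x t \<le> P"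
      using inside unfolding eventually_at_top_linorder by (auto intro!: exI[of _ 0] less_imp_le)
    fix c d assume c: "0 < c" "\<forall>\<^sub>F t in at_top. x t \<le> c" and d: "?g c < d"
    obtain w where w: "f\<^sub>2 c < w" "f\<^sub>1 w < d"
      using isCont_greater_right[OF f1(5) d] f2(2)[OF c(1)] by blast
    have "\<forall>\<^sub>F t in at_top. y t \<le> w"
      using c w by (intro delayed_relaxation_attracts(2)[OF Y nonneg(1), of c]) auto
    then show "\<forall>\<^sub>F t in at_top. x t \<le> d"
      using w by (intro delayed_relaxation_attracts(2)[OF X nonneg(2), of w]) auto
  qed

  \<comment> \<open>The limits of both components\<close>
  have x_lim: "(x \<longlongrightarrow> K) at_top"
  proof (rule order_tendstoI)
    fix c assume "c < K"
    then obtain d where "c < d" "d < K" using dense by blast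
    then show "\<forall>\<^sub>F t in at_top. c < x t" using lower[of d] by (auto elim: eventually_mono)
  next
    fix c assume "K < c"
    then obtain d where "K < d" "d < c" using dense by blast
    then show "\<forall>\<^sub>F t in at_top. x t < c" using upper[of d] by (auto elim: eventually_mono)
  qed
  have "(y \<longlongrightarrow> f\<^sub>2 K) at_top"
  proof (rule order_tendstoI)
    fix c assume "c < f\<^sub>2 K"
    then obtain d where d: "c < d" "d < f\<^sub>2 K" using dense by blast
    \<comment> \<open>Continuity of \<open>f\<^sub>2\<close> at \<open>K\<close> turns the
      asymptotic bound \<open>z\<close> for \<open>x\<close> into the bound \<open>d\<close> for
      \<open>y\<close> after one attraction step.\<close>
    obtain z where "0 < z" "z < K" "d < f\<^sub>2 z"
      using isCont_less_left[OF f2(5)[OF K] K d(2)] by blast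
    then have "\<forall>\<^sub>F t in at_top. d \<le> y t"
      by (intro delayed_relaxation_attracts(1)[OF Y nonneg(1), of z] lower) auto
    then show "\<forall>\<^sub>F t in at_top. c < y t" using d(1) by (auto elim: eventually_mono)
  next
    fix c assume "f\<^sub>2 K < c"
    then obtain d where d: "d < c" "f\<^sub>2 K < d" using dense by blast
    obtain z where "K < z" "f\<^sub>2 z < d"
      using isCont_greater_right[OF f2(5)[OF K] d(2)] by blast
    then have "\<forall>\<^sub>F t in at_top. y t \<le> d"
      by (intro delayed_relaxation_attracts(2)[OF Y nonneg(1), of z] upper) auto
    then show "\<forall>\<^sub>F t in at_top. y t < c" using d(1) by (auto elim: eventually_mono)
  qed
  with x_lim show ?thesis by (rule tendsto_Pair)
qed

end
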